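(* Let $(\gamma_n)_{n\ge1}\subset(0,1)$ be an increasing sequence with $\gamma_n\to1$, and equip $\ell_1$ with the equivalent norm $$\|x\|_{\mathrm L}=\sup_{m\ge1}\gamma_m\sum_{j=m}^{\infty}|x_j|,\qquad x=(x_j)\in\ell_1.$$ Let $$K=\Big\{x=(x_j)\in\ell_1:\ x_j\ge0\ \text{for all } j,\ \sum_{j=1}^\infty x_j=1\Big\},$$ let $(e_j)$ be the canonical unit vectors of $\ell_1$, and define $S,W\colon K\to K$ by $S(x_1,x_2,x_3,\ldots)=(0,x_1,x_2,x_3,\ldots)$ and $$W(x)=\Big(1-\sum_{j=1}^{\infty}w_jx_j\Big)e_1+\sum_{j=1}^{\infty}w_jx_je_{j+1},\qquad w_j:=\frac{\gamma_j}{\gamma_{j+1}}.$$ Then the following assertions hold. (1) The canonical right shift $S$ is not asymptotically Hölder nonexpansive with respect to $\|\cdot\|_{\mathrm L}$. (2) The balanced weighted shift $W$ is affine and fixed point free, and satisfies $$\sup_{n\ge1}\operatorname{Lip}_{\mathrm L}(W^n)\le\frac1{\gamma_1}.$$ Nevertheless, $W$ is not asymptotically Hölder nonexpansive with respect to $\|\cdot\|_{\mathrm L}$.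
   Context: For $T\colon K\to K$, $\operatorname{Lip}_{\mathrm L}(T)=\sup_{x,y\in K,\ x\neq y}\frac{\|Tx-Ty\|_{\mathrm L}}{\|x-y\|_{\mathrm L}}$, and $T^n$ is the $n$-th iterate of $T$. A mapping $T\colon K\to K$ is asymptotically Hölder nonexpansive (with respect to $\|\cdot\|_{\mathrm L}$) if there exist sequences $(\alpha_n)\subset(0,1]$ and $(\varepsilon_n)\subset[0,\infty)$ such that $\alpha_n\to1$, $\varepsilon_n\to0$, and $\|T^n x-T^n y\|_{\mathrm L}\le(1+\varepsilon_n)\|x-y\|_{\mathrm L}^{\alpha_n}$ for all $x,y\in K$ and $n\ge1$. *)

theory Defs
  imports Complex_Main "HOL-Library.Extended_Real"
begin

text \<open>
  Sequences are functions on \<^typ>\<open>nat\<close>, indexed from 0: the coordinate $x_j$ and the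
  parameter $\gamma_j$ ($j \ge 1$) are rendered as \<open>x (j - 1)\<close> and \<open>\<gamma> (j - 1)\<close>.
  Iterates \<open>T ^^ n\<close> keep their own numbering.
\<close>

definition ell1 :: "(nat \<Rightarrow> real) set" where
  "ell1 = {x. summable (\<lambda>j. \<bar>x j\<bar>)}"

definition unit_vec :: "nat \<Rightarrow> nat \<Rightarrow> real" where
  "unit_vec j = (\<lambda>k. if k = j then 1 else 0)"

text \<open>The supremum is finite on \<^const>\<open>ell1\<close>, the only place where the norm is meaningful.\<close>

definition norm_L :: "(nat \<Rightarrow> real) \<Rightarrow> (nat \<Rightarrow> real) \<Rightarrow> real" where
  "norm_L \<gamma> x = (SUP m. \<gamma> m * (\<Sum>j. \<bar>x (m + j)\<bar>))"

definition K :: "(nat \<Rightarrow> real) set" where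
  "K = {x \<in> ell1. (\<forall>j. 0 \<le> x j) \<and> (\<Sum>j. x j) = 1}"

definition right_shift :: "(nat \<Rightarrow> real) \<Rightarrow> nat \<Rightarrow> real" where
  "right_shift x = (\<lambda>k. case k of 0 \<Rightarrow> 0 | Suc j \<Rightarrow> x j)"

definition balanced_weight :: "(nat \<Rightarrow> real) \<Rightarrow> nat \<Rightarrow> real" where
  "balanced_weight \<gamma> j = \<gamma> j / \<gamma> (Suc j)"

text \<open>The vector-valued series is summed coordinatewise; at each coordinate at most one term
  is nonzero.\<close>

definition balanced_shift :: "(nat \<Rightarrow> real) \<Rightarrow> (nat \<Rightarrow> real) \<Rightarrow> nat \<Rightarrow> real" where
  "balanced_shift \<gamma> x = (\<lambda>k.
     (1 - (\<Sum>j. balanced_weight \<gamma> j * x j)) * unit_vec 0 k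
     + (\<Sum>j. balanced_weight \<gamma> j * x j * unit_vec (Suc j) k))"

text \<open>Extended-real valued, so that non-Lipschitz maps get the value \<open>\<infinity>\<close>.\<close>

definition Lip_L :: "(nat \<Rightarrow> real) \<Rightarrow> ((nat \<Rightarrow> real) \<Rightarrow> nat \<Rightarrow> real) \<Rightarrow> ereal" where
  "Lip_L \<gamma> T = (SUP (x, y) \<in> {(x, y). x \<in> K \<and> y \<in> K \<and> x \<noteq> y}.
     ereal (norm_L \<gamma> (T x - T y) / norm_L \<gamma> (x - y)))"

definition asymp_Hoelder_nonexpansive ::
    "(nat \<Rightarrow> real) \<Rightarrow> ((nat \<Rightarrow> real) \<Rightarrow> nat \<Rightarrow> real) \<Rightarrow> bool" where
  "asymp_Hoelder_nonexpansive \<gamma> T \<longleftrightarrow>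
     (\<exists>\<alpha> \<epsilon> :: nat \<Rightarrow> real.
        (\<forall>n\<ge>1. 0 < \<alpha> n \<and> \<alpha> n \<le> 1) \<and> (\<forall>n\<ge>1. 0 \<le> \<epsilon> n) \<and>
        \<alpha> \<longlonglongrightarrow> 1 \<and> \<epsilon> \<longlonglongrightarrow> 0 \<and>
        (\<forall>x\<in>K. \<forall>y\<in>K. \<forall>n\<ge>1.
           norm_L \<gamma> ((T ^^ n) x - (T ^^ n) y) \<le> (1 + \<epsilon> n) * norm_L \<gamma> (x - y) powr \<alpha> n))"

definition affine_on_K :: "((nat \<Rightarrow> real) \<Rightarrow> nat \<Rightarrow> real) \<Rightarrow> bool" where
  "affine_on_K T \<longleftrightarrow>
     (\<forall>x\<in>K. \<forall>y\<in>K. \<forall>t::real. 0 \<le> t \<and> t \<le> 1 \<longrightarrow>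
        T (\<lambda>j. (1 - t) * x j + t * y j) = (\<lambda>j. (1 - t) * T x j + t * T y j))"

definition fixed_point_free_on_K :: "((nat \<Rightarrow> real) \<Rightarrow> nat \<Rightarrow> real) \<Rightarrow> bool" where
  "fixed_point_free_on_K T \<longleftrightarrow> \<not> (\<exists>x\<in>K. T x = x)"


text \<open>
  The objects above are well defined: \<^const>\<open>norm_L\<close> is an equivalent norm on
  \<^const>\<open>ell1\<close>, and both shifts map \<^const>\<open>K\<close> into itself.
\<close>

lemma norm_L_bounds:
  fixes \<gamma> x :: "nat \<Rightarrow> real"
  assumes g: "\<And>n. 0 < \<gamma> n" "\<And>n. \<gamma> n < 1" and x: "x \<in> ell1"
  shows bdd_above_norm_L: "bdd_above (range (\<lambda>m. \<gamma> m * (\<Sum>j. \<bar>x (m + j)\<bar>)))"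
    and norm_L_le_ell1: "norm_L \<gamma> x \<le> (\<Sum>j. \<bar>x j\<bar>)"
    and ell1_le_norm_L: "\<gamma> 0 * (\<Sum>j. \<bar>x j\<bar>) \<le> norm_L \<gamma> x"
proof -
  have s: "summable (\<lambda>j. \<bar>x j\<bar>)" using x by (simp add: ell1_def)
  have b: "\<gamma> m * (\<Sum>j. \<bar>x (m + j)\<bar>) \<le> (\<Sum>j. \<bar>x j\<bar>)" for m
  proof -
    have e: "(\<Sum>j. \<bar>x j\<bar>) = (\<Sum>j. \<bar>x (j + m)\<bar>) + (\<Sum>j<m. \<bar>x j\<bar>)"
      using suminf_split_initial_segment[OF s, of m] by simp
    have sm: "summable (\<lambda>j. \<bar>x (m + j)\<bar>)"
      using s summable_ignore_initial_segment[of "\<lambda>j. \<bar>x j\<bar>" m] by (simp add: add.commute)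
    have p: "0 \<le> (\<Sum>j. \<bar>x (m + j)\<bar>)" by (rule suminf_nonneg[OF sm]) simp
    have "\<gamma> m * (\<Sum>j. \<bar>x (m + j)\<bar>) \<le> 1 * (\<Sum>j. \<bar>x (m + j)\<bar>)"
      by (rule mult_right_mono) (use g(2)[of m] p in auto)
    moreover have "0 \<le> (\<Sum>j<m. \<bar>x j\<bar>)" by (simp add: sum_nonneg)
    ultimately show ?thesis using e unfolding add.commute[of _ m] by linarith
  qed
  show bd: "bdd_above (range (\<lambda>m. \<gamma> m * (\<Sum>j. \<bar>x (m + j)\<bar>)))"
    using b by (auto simp: bdd_above_def)
  show "norm_L \<gamma> x \<le> (\<Sum>j. \<bar>x j\<bar>)"
    unfolding norm_L_def by (rule cSUP_least) (use b in auto)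
  show "\<gamma> 0 * (\<Sum>j. \<bar>x j\<bar>) \<le> norm_L \<gamma> x"
    unfolding norm_L_def using cSUP_upper[OF UNIV_I bd, of 0] by simp
qed

lemma norm_L_triangle:
  fixes \<gamma> x y :: "nat \<Rightarrow> real"
  assumes g: "\<And>n. 0 < \<gamma> n" "\<And>n. \<gamma> n < 1" and x: "x \<in> ell1" and y: "y \<in> ell1"
  shows "norm_L \<gamma> (\<lambda>j. x j + y j) \<le> norm_L \<gamma> x + norm_L \<gamma> y"
proof -
  have *: "summable (\<lambda>j. \<bar>z (m + j)\<bar>)" if "z \<in> ell1" for z m
    using that summable_ignore_initial_segment[of "\<lambda>j. \<bar>z j\<bar>" m]
    by (simp add: add.commute ell1_def)
  have "\<gamma> m * (\<Sum>j. \<bar>x (m + j) + y (m + j)\<bar>) \<le> norm_L \<gamma> x + norm_L \<gamma> y" for m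
  proof -
    have s: "summable (\<lambda>j. \<bar>x (m + j)\<bar> + \<bar>y (m + j)\<bar>)" by (intro summable_add * x y)
    have "(\<Sum>j. \<bar>x (m + j) + y (m + j)\<bar>) \<le> (\<Sum>j. \<bar>x (m + j)\<bar> + \<bar>y (m + j)\<bar>)"
      by (rule suminf_le) (auto intro!: abs_triangle_ineq s summable_comparison_test[OF _ s])
    also have "\<dots> = (\<Sum>j. \<bar>x (m + j)\<bar>) + (\<Sum>j. \<bar>y (m + j)\<bar>)"
      using suminf_add[OF *[OF x] *[OF y], of m m] by simp
    finally have "\<gamma> m * (\<Sum>j. \<bar>x (m + j) + y (m + j)\<bar>)
        \<le> \<gamma> m * (\<Sum>j. \<bar>x (m + j)\<bar>) + \<gamma> m * (\<Sum>j. \<bar>y (m + j)\<bar>)"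
      using g(1)[of m] by (simp add: distrib_left[symmetric])
    also have "\<dots> \<le> norm_L \<gamma> x + norm_L \<gamma> y"
      unfolding norm_L_def
      by (intro add_mono cSUP_upper bdd_above_norm_L g x y UNIV_I)
    finally show ?thesis .
  qed
  then show ?thesis
    unfolding norm_L_def[of \<gamma> "\<lambda>j. x j + y j"] by (intro cSUP_least) auto
qed

lemma norm_L_scale:
  fixes \<gamma> x :: "nat \<Rightarrow> real"
  assumes g: "\<And>n. 0 < \<gamma> n" "\<And>n. \<gamma> n < 1" and x: "x \<in> ell1"
  shows "norm_L \<gamma> (\<lambda>j. c * x j) = \<bar>c\<bar> * norm_L \<gamma> x"
proof -
  have le: "norm_L \<gamma> (\<lambda>j. c * z j) \<le> \<bar>c\<bar> * norm_L \<gamma> z" if z: "z \<in> ell1" for c z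
  proof -
    have sz: "summable (\<lambda>j. \<bar>z (m + j)\<bar>)" for m
      using z summable_ignore_initial_segment[of "\<lambda>j. \<bar>z j\<bar>" m]
      by (simp add: add.commute ell1_def)
    have "\<gamma> m * (\<Sum>j. \<bar>c * z (m + j)\<bar>) \<le> \<bar>c\<bar> * norm_L \<gamma> z" for m
    proof -
      have "\<gamma> m * (\<Sum>j. \<bar>c * z (m + j)\<bar>) = \<bar>c\<bar> * (\<gamma> m * (\<Sum>j. \<bar>z (m + j)\<bar>))"
        using suminf_mult[OF sz, of "\<bar>c\<bar>"] by (simp add: abs_mult)
      also have "\<dots> \<le> \<bar>c\<bar> * norm_L \<gamma> z"
        unfolding norm_L_def by (intro mult_left_mono cSUP_upper bdd_above_norm_L g z UNIV_I) simp
      finally show ?thesis .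
    qed
    then show ?thesis unfolding norm_L_def[of \<gamma> "\<lambda>j. c * z j"] by (intro cSUP_least) auto
  qed
  show ?thesis
  proof (cases "c = 0")
    case True
    then show ?thesis by (simp add: norm_L_def)
  next
    case False
    have "(\<lambda>j. c * x j) \<in> ell1"
      using x summable_mult[of "\<lambda>j. \<bar>x j\<bar>" "\<bar>c\<bar>"] by (simp add: ell1_def abs_mult)
    from le[OF this, of "inverse c"] False
    have "norm_L \<gamma> x \<le> inverse \<bar>c\<bar> * norm_L \<gamma> (\<lambda>j. c * x j)"
      by (simp add: mult.assoc[symmetric])
    then have "\<bar>c\<bar> * norm_L \<gamma> x \<le> norm_L \<gamma> (\<lambda>j. c * x j)"
      using False by (simp add: field_simps)
    with le[OF x, of c] show ?thesis by simp
  qed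
qed

lemma right_shift_K: "right_shift x \<in> K" if "x \<in> K"
proof -
  have s: "summable (\<lambda>j. \<bar>x j\<bar>)" and n: "\<And>j. 0 \<le> x j" and e: "(\<Sum>j. x j) = 1"
    using that by (auto simp: K_def ell1_def)
  have "x sums 1" using s n e by (simp add: sums_iff)
  then have "right_shift x sums 1"
    using sums_Suc_iff[of "right_shift x" 1] by (simp add: right_shift_def)
  moreover have "0 \<le> right_shift x j" for j
    using n by (simp add: right_shift_def split: nat.split)
  ultimately show ?thesis by (simp add: K_def ell1_def sums_iff)
qed

lemma balanced_shift_0: "balanced_shift \<gamma> x 0 = 1 - (\<Sum>j. balanced_weight \<gamma> j * x j)"
  by (simp add: balanced_shift_def unit_vec_def)

lemma balanced_shift_Suc: "balanced_shift \<gamma> x (Suc k) = balanced_weight \<gamma> k * x k"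
proof -
  have "(\<Sum>j. balanced_weight \<gamma> j * x j * unit_vec (Suc j) (Suc k))
      = (\<Sum>j\<in>{k}. balanced_weight \<gamma> j * x j * unit_vec (Suc j) (Suc k))"
    by (rule suminf_finite) (auto simp: unit_vec_def)
  then show ?thesis by (simp add: balanced_shift_def unit_vec_def)
qed

lemma balanced_shift_K:
  fixes \<gamma> :: "nat \<Rightarrow> real"
  assumes g: "\<And>n. 0 < \<gamma> n" "mono \<gamma>" and x: "x \<in> K"
  shows "balanced_shift \<gamma> x \<in> K"
proof -
  have s: "summable x" and n: "\<And>j. 0 \<le> x j" and e: "(\<Sum>j. x j) = 1"
    using x by (auto simp: K_def ell1_def)
  have w: "0 \<le> balanced_weight \<gamma> j" "balanced_weight \<gamma> j \<le> 1" for j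
    using g(1)[of j] g(1)[of "Suc j"] monoD[OF g(2), of j "Suc j"]
    by (auto simp: balanced_weight_def)
  have le: "balanced_weight \<gamma> j * x j \<le> x j" for j
    using w[of j] n[of j] by (simp add: mult_left_le_one_le)
  have sw: "summable (\<lambda>j. balanced_weight \<gamma> j * x j)"
    by (rule summable_comparison_test[OF _ s]) (use le w n in \<open>auto simp: abs_mult\<close>)
  have "(\<Sum>j. balanced_weight \<gamma> j * x j) \<le> 1"
    using suminf_le[OF le sw s] e by simp
  then have p: "0 \<le> balanced_shift \<gamma> x k" for k
    using w n by (cases k) (auto simp: balanced_shift_0 balanced_shift_Suc)
  have "(\<lambda>k. balanced_shift \<gamma> x (Suc k)) sums (\<Sum>j. balanced_weight \<gamma> j * x j)"
    using sw by (simp add: balanced_shift_Suc summable_sums)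
  then have "balanced_shift \<gamma> x sums 1"
    using sums_Suc_iff[of "balanced_shift \<gamma> x" "\<Sum>j. balanced_weight \<gamma> j * x j"]
    by (simp add: balanced_shift_0)
  with p show ?thesis by (simp add: K_def ell1_def sums_iff)
qed

end

theory Submission
  imports Defs
begin

text \<open>
  Both negative assertions come from one asymptotic test. If \<open>T\<close> is asymptotically Hoelder
  nonexpansive, then letting \<open>n\<close> tend to infinity in the defining inequality, for a fixed pair
  \<open>x\<close>, \<open>y\<close> at positive distance, bounds every limit of lower bounds of \<open>norm_L \<gamma> (T\<^sup>n x - T\<^sup>n y)\<close> by
  \<open>norm_L \<gamma> (x - y)\<close> (lemma \<open>asymp_Hoelder_limit_le\<close>).

  The test pair is \<open>e\<^sub>0\<close>, \<open>e\<^sub>k\<close> with \<open>k > 0\<close>. Its distance is at most \<open>max (2 \<gamma> 0) (\<gamma> k)\<close>. After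
  \<open>n\<close> steps the two masses sit at the positions \<open>n\<close> and \<open>n + k\<close>, so the norm of the difference
  is at least \<open>\<gamma> n\<close> times their total. The right shift keeps them equal to 1, so this lower bound
  tends to 2, which exceeds the distance for every \<open>k\<close>. The balanced shift multiplies them by
  \<open>\<gamma> 0 / \<gamma> n\<close> and \<open>\<gamma> k / \<gamma> (n + k)\<close>, as the weights telescope, and the lower bound tends to
  \<open>\<gamma> 0 + \<gamma> k\<close>. This exceeds the distance as soon as \<open>\<gamma> 0 < \<gamma> k\<close>; such a \<open>k\<close> exists because \<open>\<gamma>\<close>
  stays below its limit 1.

  The Lipschitz bound holds because on differences of elements of \<^const>\<open>K\<close>, whose coordinates
  add up to 0, the balanced shift agrees with the linear operator that moves the fraction
  \<open>\<gamma> j / \<gamma> (j + 1)\<close> of the mass at \<open>j\<close> to \<open>j + 1\<close> and the rest to 0. This operator is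
  stochastic, so it does not increase the \<open>\<ell>\<^sub>1\<close> norm; the constant \<open>1 / \<gamma> 0\<close> is the price of
  comparing the two norms. A fixed point \<open>x\<close> would have \<open>\<gamma> j * x j\<close> independent of \<open>j\<close>, which for a summable \<open>x\<close> forces \<open>x = 0\<close>.
\<close>

section \<open>Elements of the simplex\<close>

lemma summable_K: "summable x" if "x \<in> K"
  using that by (auto simp: K_def ell1_def)

lemma diff_K_ell1: "x - y \<in> ell1" if "x \<in> K" "y \<in> K"
proof -
  have "summable (\<lambda>j. x j + y j)"
    using that by (intro summable_add summable_K)
  then have "summable (\<lambda>j. \<bar>x j - y j\<bar>)"
  proof (rule summable_comparison_test[rotated], intro exI allI impI)
    fix j
    have "0 \<le> x j" "0 \<le> y j"
      using that by (auto simp: K_def)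
    then show "norm \<bar>x j - y j\<bar> \<le> x j + y j"
      by simp
  qed
  then show ?thesis
    by (simp add: ell1_def)
qed

lemma unit_vec_shift_sums: "(\<lambda>j. unit_vec k (m + j)) sums (if m \<le> k then 1 else 0)"
proof (cases "m \<le> k")
  case True
  then have "(\<lambda>j. unit_vec k (m + j)) = (\<lambda>j. if j = k - m then 1 else 0)"
    by (auto simp: unit_vec_def fun_eq_iff)
  then show ?thesis
    using True sums_single[of "k - m" "\<lambda>_. 1 :: real"] by simp
next
  case False
  then have "(\<lambda>j. unit_vec k (m + j)) = (\<lambda>j. 0)"
    by (auto simp: unit_vec_def fun_eq_iff)
  then show ?thesis
    using False by simp
qed

lemma unit_vec_K: "unit_vec k \<in> K"
proof -
  have "unit_vec k sums 1"
    using unit_vec_shift_sums[of k 0] by simp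
  moreover have "0 \<le> unit_vec k j" for j
    by (simp add: unit_vec_def)
  ultimately show ?thesis
    by (simp add: K_def ell1_def sums_iff)
qed

section \<open>Estimates for the renorming\<close>

lemma norm_L_ge_finite_sum:
  assumes g: "\<And>n. 0 < \<gamma> n" "\<And>n. \<gamma> n < 1" and z: "z \<in> ell1" and A: "finite A"
  shows "\<gamma> m * (\<Sum>j\<in>A. \<bar>z (m + j)\<bar>) \<le> norm_L \<gamma> z"
proof -
  have "summable (\<lambda>j. \<bar>z (m + j)\<bar>)"
    using z summable_ignore_initial_segment[of "\<lambda>j. \<bar>z j\<bar>" m]
    by (simp add: add.commute ell1_def)
  then have "(\<Sum>j\<in>A. \<bar>z (m + j)\<bar>) \<le> (\<Sum>j. \<bar>z (m + j)\<bar>)"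
    by (rule sum_le_suminf[OF _ A]) simp
  then have "\<gamma> m * (\<Sum>j\<in>A. \<bar>z (m + j)\<bar>) \<le> \<gamma> m * (\<Sum>j. \<bar>z (m + j)\<bar>)"
    using g(1)[of m] by simp
  also have "\<dots> \<le> norm_L \<gamma> z"
    unfolding norm_L_def by (intro cSUP_upper bdd_above_norm_L g z UNIV_I)
  finally show ?thesis .
qed

lemma norm_L_unit_vec_diff_le:
  assumes g: "\<And>n. 0 < \<gamma> n" and mono: "mono \<gamma>" and k: "0 < k"
  shows "norm_L \<gamma> (unit_vec 0 - unit_vec k) \<le> max (2 * \<gamma> 0) (\<gamma> k)"
  unfolding norm_L_def
proof (rule cSUP_least)
  fix m
  \<comment> \<open>The supports are disjoint, so the absolute value of the difference is the sum.\<close>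
  have "(\<lambda>j. \<bar>(unit_vec 0 - unit_vec k) (m + j)\<bar>)
      = (\<lambda>j. unit_vec 0 (m + j) + unit_vec k (m + j))"
    using k by (auto simp: unit_vec_def fun_eq_iff)
  also have "\<dots> sums ((if m \<le> 0 then 1 else 0) + (if m \<le> k then 1 else 0))"
    by (intro sums_add unit_vec_shift_sums)
  finally have "(\<Sum>j. \<bar>(unit_vec 0 - unit_vec k) (m + j)\<bar>)
      = (if m \<le> 0 then 1 else 0) + (if m \<le> k then 1 else 0)"
    by (simp only: sums_iff)
  moreover have "\<gamma> m \<le> \<gamma> k" if "m \<le> k"
    using mono that by (rule monoD)
  ultimately show "\<gamma> m * (\<Sum>j. \<bar>(unit_vec 0 - unit_vec k) (m + j)\<bar>) \<le> max (2 * \<gamma> 0) (\<gamma> k)"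
    using g[of 0] by auto
qed simp

lemma norm_L_unit_vec_diff_pos:
  assumes g: "\<And>n. 0 < \<gamma> n" "\<And>n. \<gamma> n < 1" and k: "0 < k"
  shows "0 < norm_L \<gamma> (unit_vec 0 - unit_vec k)"
proof -
  have "\<gamma> 0 * (\<Sum>j\<in>{0}. \<bar>(unit_vec 0 - unit_vec k) (0 + j)\<bar>) \<le> norm_L \<gamma> (unit_vec 0 - unit_vec k)"
    by (intro norm_L_ge_finite_sum g diff_K_ell1 unit_vec_K) simp
  then show ?thesis
    using g(1)[of 0] k by (simp add: unit_vec_def)
qed

section \<open>The asymptotic test\<close>

lemma asymp_Hoelder_limit_le:
  assumes T: "asymp_Hoelder_nonexpansive \<gamma> T" and x: "x \<in> K" and y: "y \<in> K"
    and pos: "0 < norm_L \<gamma> (x - y)"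
    and lower: "\<And>n. f n \<le> norm_L \<gamma> ((T ^^ n) x - (T ^^ n) y)"
    and f: "f \<longlonglongrightarrow> l"
  shows "l \<le> norm_L \<gamma> (x - y)"
proof -
  obtain \<alpha> \<epsilon> :: "nat \<Rightarrow> real" where \<alpha>: "\<alpha> \<longlonglongrightarrow> 1" and \<epsilon>: "\<epsilon> \<longlonglongrightarrow> 0"
    and bound: "\<And>n. 1 \<le> n \<Longrightarrow>
      norm_L \<gamma> ((T ^^ n) x - (T ^^ n) y) \<le> (1 + \<epsilon> n) * norm_L \<gamma> (x - y) powr \<alpha> n"
    using T x y unfolding asymp_Hoelder_nonexpansive_def by blast
  have "(\<lambda>n. (1 + \<epsilon> n) * norm_L \<gamma> (x - y) powr \<alpha> n) \<longlonglongrightarrow> (1 + 0) * norm_L \<gamma> (x - y) powr 1"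
    using pos by (intro tendsto_intros \<alpha> \<epsilon>) auto
  moreover have "f n \<le> (1 + \<epsilon> n) * norm_L \<gamma> (x - y) powr \<alpha> n" if "1 \<le> n" for n
    using lower[of n] bound[OF that] by linarith
  ultimately have "l \<le> (1 + 0) * norm_L \<gamma> (x - y) powr 1"
    using f by (intro LIMSEQ_le) auto
  then show ?thesis
    using pos by simp
qed

text \<open>
  The test specialised to \<open>e\<^sub>0\<close> and \<open>e\<^sub>k\<close>: the iterates of \<open>T\<close> carry the coordinate \<open>j\<close> to the
  coordinate \<open>n + j\<close> with the factor \<open>c n j\<close>, whatever else they do on the first \<open>n\<close> coordinates.
  Only the limits \<open>a\<close>, \<open>b\<close> of the factors at 0 and \<open>k\<close> matter.
\<close>

lemma shift_not_asymp_Hoelder: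
  assumes g: "\<And>n. 0 < \<gamma> n" "\<And>n. \<gamma> n < 1" and mono: "mono \<gamma>" and lim: "\<gamma> \<longlonglongrightarrow> 1"
    and k: "0 < k"
    and T_K: "\<And>x. x \<in> K \<Longrightarrow> T x \<in> K"
    and shift: "\<And>n j x. (T ^^ n) x (n + j) = c n j * x j"
    and c: "\<And>n j. 0 \<le> c n j" "(\<lambda>n. c n 0) \<longlonglongrightarrow> a" "(\<lambda>n. c n k) \<longlonglongrightarrow> b"
    and large: "max (2 * \<gamma> 0) (\<gamma> k) < a + b"
  shows "\<not> asymp_Hoelder_nonexpansive \<gamma> T"
proof
  assume T: "asymp_Hoelder_nonexpansive \<gamma> T"
  let ?d = "\<lambda>n. (T ^^ n) (unit_vec 0) - (T ^^ n) (unit_vec k)"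
  have iter_K: "(T ^^ n) x \<in> K" if "x \<in> K" for n x
    using that by (induction n) (auto intro: T_K)
  have lower: "\<gamma> n * (c n 0 + c n k) \<le> norm_L \<gamma> (?d n)" for n
  proof -
    have "?d n (n + j) = c n j * (unit_vec 0 j - unit_vec k j)" for j
      by (simp add: shift right_diff_distrib)
    then have "(\<Sum>j\<in>{0, k}. \<bar>?d n (n + j)\<bar>) = c n 0 + c n k"
      using k c(1) by (simp add: unit_vec_def del: fun_diff_def minus_apply)
    moreover have "\<gamma> n * (\<Sum>j\<in>{0, k}. \<bar>?d n (n + j)\<bar>) \<le> norm_L \<gamma> (?d n)"
      by (intro norm_L_ge_finite_sum g diff_K_ell1 iter_K unit_vec_K) simp
    ultimately show ?thesis
      by simp
  qed
  have "(\<lambda>n. \<gamma> n * (c n 0 + c n k)) \<longlonglongrightarrow> 1 * (a + b)"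
    by (intro tendsto_intros lim c)
  from asymp_Hoelder_limit_le[OF T unit_vec_K unit_vec_K norm_L_unit_vec_diff_pos[OF g k] lower this]
  have "a + b \<le> norm_L \<gamma> (unit_vec 0 - unit_vec k)"
    by simp
  also have "\<dots> \<le> max (2 * \<gamma> 0) (\<gamma> k)"
    by (rule norm_L_unit_vec_diff_le[OF g(1) mono k])
  finally show False
    using large by simp
qed

lemma ex_parameter_gt_first:
  fixes \<gamma> :: "nat \<Rightarrow> real"
  assumes "\<And>n. \<gamma> n < 1" and lim: "\<gamma> \<longlonglongrightarrow> 1"
  obtains k where "0 < k" "\<gamma> 0 < \<gamma> k"
proof -
  have "eventually (\<lambda>k. \<gamma> 0 < \<gamma> k) sequentially"
    using lim assms(1)[of 0] by (rule order_tendstoD)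
  then obtain k where "\<gamma> 0 < \<gamma> k"
    by (auto simp: eventually_sequentially)
  then show ?thesis
    by (intro that[of k]) (auto intro: gr0I)
qed

section \<open>The right shift\<close>

lemma right_shift_iterate: "(right_shift ^^ n) x (n + j) = x j"
  by (induction n) (simp_all add: right_shift_def)

lemma right_shift_not_asymp_Hoelder:
  assumes g: "\<And>n. 0 < \<gamma> n" "\<And>n. \<gamma> n < 1" and mono: "mono \<gamma>" and lim: "\<gamma> \<longlonglongrightarrow> 1"
  shows "\<not> asymp_Hoelder_nonexpansive \<gamma> right_shift"
proof (rule shift_not_asymp_Hoelder[OF g mono lim, where k = 1 and c = "\<lambda>_ _. 1"])
  show "max (2 * \<gamma> 0) (\<gamma> 1) < 1 + 1"
    using g(2)[of 0] g(2)[of 1] by simp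
qed (auto simp: right_shift_iterate right_shift_K)

section \<open>The balanced shift\<close>

lemma balanced_weight_bounds:
  fixes \<gamma> :: "nat \<Rightarrow> real"
  assumes "\<And>n. 0 < \<gamma> n" and "mono \<gamma>"
  shows "0 \<le> balanced_weight \<gamma> j" and "balanced_weight \<gamma> j \<le> 1"
  using assms(1)[of j] assms(1)[of "Suc j"] monoD[OF assms(2), of j "Suc j"]
  by (auto simp: balanced_weight_def)

lemma summable_balanced_weight_mult:
  fixes \<gamma> :: "nat \<Rightarrow> real"
  assumes "\<And>n. 0 < \<gamma> n" and "mono \<gamma>" and x: "x \<in> K"
  shows "summable (\<lambda>j. balanced_weight \<gamma> j * x j)"
proof (rule summable_comparison_test[OF _ summable_K[OF x]], intro exI allI impI)
  fix j
  have "0 \<le> x j"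
    using x by (simp add: K_def)
  then show "norm (balanced_weight \<gamma> j * x j) \<le> x j"
    using balanced_weight_bounds[OF assms(1,2), of j] by (simp add: abs_mult mult_left_le_one_le)
qed

lemma balanced_shift_iterate_K:
  fixes \<gamma> :: "nat \<Rightarrow> real"
  assumes "\<And>n. 0 < \<gamma> n" and "mono \<gamma>" and "x \<in> K"
  shows "(balanced_shift \<gamma> ^^ n) x \<in> K"
  using assms by (induction n) (auto intro: balanced_shift_K)

lemma balanced_shift_iterate:
  assumes g: "\<And>n. 0 < \<gamma> n"
  shows "(balanced_shift \<gamma> ^^ n) x (n + j) = \<gamma> j / \<gamma> (n + j) * x j"
proof (induction n)
  case 0
  show ?case
    using g[of j] by simp
next
  case (Suc n)
  then show ?case
    using g[of "n + j"] by (simp add: balanced_shift_Suc balanced_weight_def)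
qed

lemma balanced_shift_affine:
  fixes \<gamma> :: "nat \<Rightarrow> real"
  assumes g: "\<And>n. 0 < \<gamma> n" and mono: "mono \<gamma>"
  shows "affine_on_K (balanced_shift \<gamma>)"
  unfolding affine_on_K_def
proof (intro ballI allI impI ext)
  fix x y t k
  assume x: "x \<in> K" and y: "y \<in> K"
  let ?w = "balanced_weight \<gamma>"
  note s = summable_balanced_weight_mult[OF g mono]
  have "(\<Sum>j. ?w j * ((1 - t) * x j + t * y j))
      = (\<Sum>j. (1 - t) * (?w j * x j) + t * (?w j * y j))"
    by (simp add: algebra_simps)
  also have "\<dots> = (1 - t) * (\<Sum>j. ?w j * x j) + t * (\<Sum>j. ?w j * y j)"
    using s[OF x] s[OF y] by (simp add: suminf_add[symmetric] suminf_mult summable_mult)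
  finally show "balanced_shift \<gamma> (\<lambda>j. (1 - t) * x j + t * y j) k
      = (1 - t) * balanced_shift \<gamma> x k + t * balanced_shift \<gamma> y k"
    by (cases k) (simp_all add: balanced_shift_0 balanced_shift_Suc algebra_simps)
qed

lemma balanced_shift_fixed_point_free:
  fixes \<gamma> :: "nat \<Rightarrow> real"
  assumes g: "\<And>n. 0 < \<gamma> n" and lim: "\<gamma> \<longlonglongrightarrow> 1"
  shows "fixed_point_free_on_K (balanced_shift \<gamma>)"
  unfolding fixed_point_free_on_K_def
proof (rule notI, elim bexE)
  fix x
  assume x: "x \<in> K" and fp: "balanced_shift \<gamma> x = x"
  have "(balanced_shift \<gamma> ^^ n) x = x" for n
    by (induction n) (simp_all add: fp)
  then have eq: "x n = \<gamma> 0 / \<gamma> n * x 0" for n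
    using balanced_shift_iterate[of \<gamma> n x 0, OF g] by simp
  have "(\<lambda>n. \<gamma> n * x n) \<longlonglongrightarrow> 1 * 0"
    by (intro tendsto_mult lim summable_LIMSEQ_zero summable_K x)
  also have "(\<lambda>n. \<gamma> n * x n) = (\<lambda>_. \<gamma> 0 * x 0)"
  proof
    show "\<gamma> n * x n = \<gamma> 0 * x 0" for n
      using eq[of n] g[of n] by simp
  qed
  finally have "\<gamma> 0 * x 0 = 0"
    by (simp only: LIMSEQ_const_iff mult_zero_right)
  then have "x 0 = 0"
    using g[of 0] by simp
  then have "x n = 0" for n
    using eq[of n] by simp
  then have "x = (\<lambda>_. 0)"
    by (rule ext)
  then show False
    using x by (simp add: K_def)
qed

text \<open>
  As the coordinates of \<open>x - y\<close> add up to 0, the new first coordinate of the difference is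
  \<open>(\<Sum>j. (1 - w\<^sub>j) * (x j - y j))\<close>, the total of what is not shifted. Its absolute value is at
  most what the factors \<open>w\<^sub>j\<close> take away from the \<open>\<ell>\<^sub>1\<close> norm of the shifted coordinates.
\<close>

lemma balanced_shift_ell1_nonexpansive:
  fixes \<gamma> :: "nat \<Rightarrow> real"
  assumes g: "\<And>n. 0 < \<gamma> n" and mono: "mono \<gamma>" and x: "x \<in> K" and y: "y \<in> K"
  shows "(\<Sum>j. \<bar>balanced_shift \<gamma> x j - balanced_shift \<gamma> y j\<bar>) \<le> (\<Sum>j. \<bar>x j - y j\<bar>)"
proof -
  let ?w = "balanced_weight \<gamma>" and ?d = "\<lambda>j. x j - y j"
  let ?D = "\<lambda>j. balanced_shift \<gamma> x j - balanced_shift \<gamma> y j"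
  note w = balanced_weight_bounds[OF g mono]
  have sum_abs: "summable (\<lambda>j. \<bar>?d j\<bar>)"
    using diff_K_ell1[OF x y] by (simp add: ell1_def)
  have sum_d: "summable ?d" and d0: "(\<Sum>j. ?d j) = 0"
    using x y summable_K[OF x] summable_K[OF y]
    by (auto simp: K_def suminf_diff[symmetric] intro: summable_diff)
  have sum_wd: "summable (\<lambda>j. ?w j * ?d j)"
    and D0: "?D 0 = - (\<Sum>j. ?w j * ?d j)"
    using summable_balanced_weight_mult[OF g mono x] summable_balanced_weight_mult[OF g mono y]
    by (auto simp: right_diff_distrib balanced_shift_0 suminf_diff[symmetric] intro: summable_diff)
  have sum_w_abs: "summable (\<lambda>j. ?w j * \<bar>?d j\<bar>)"
    by (rule summable_comparison_test[OF _ sum_abs])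
      (use w in \<open>auto simp: abs_mult mult_left_le_one_le\<close>)
  have sum_v_abs: "summable (\<lambda>j. (1 - ?w j) * \<bar>?d j\<bar>)"
    using summable_diff[OF sum_abs sum_w_abs] by (simp add: left_diff_distrib)
  have abs_v: "\<bar>(1 - ?w j) * ?d j\<bar> = (1 - ?w j) * \<bar>?d j\<bar>" for j
    using w[of j] by (simp add: abs_mult)
  have "?D 0 = (\<Sum>j. (1 - ?w j) * ?d j)"
    using suminf_diff[OF sum_d sum_wd] d0 D0 by (simp add: left_diff_distrib)
  also have "\<bar>\<dots>\<bar> \<le> (\<Sum>j. \<bar>(1 - ?w j) * ?d j\<bar>)"
    by (rule summable_rabs) (use sum_v_abs in \<open>simp only: abs_v\<close>)
  finally have first: "\<bar>?D 0\<bar> \<le> (\<Sum>j. (1 - ?w j) * \<bar>?d j\<bar>)"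
    by (simp only: abs_v)
  have abs_D_Suc: "\<bar>?D (Suc j)\<bar> = ?w j * \<bar>?d j\<bar>" for j
    using w[of j] by (simp add: balanced_shift_Suc right_diff_distrib[symmetric] abs_mult)
  have "summable (\<lambda>j. \<bar>?D j\<bar>)"
    using diff_K_ell1[OF balanced_shift_K[OF g mono x] balanced_shift_K[OF g mono y]]
    by (simp add: ell1_def)
  from suminf_split_head[OF this]
  have "(\<Sum>j. \<bar>?D j\<bar>) = \<bar>?D 0\<bar> + (\<Sum>j. ?w j * \<bar>?d j\<bar>)"
    by (simp only: abs_D_Suc)
  also have "\<dots> \<le> (\<Sum>j. (1 - ?w j) * \<bar>?d j\<bar>) + (\<Sum>j. ?w j * \<bar>?d j\<bar>)"
    using first by simp
  also have "\<dots> = (\<Sum>j. \<bar>?d j\<bar>)"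
    using suminf_add[OF sum_v_abs sum_w_abs] by (simp add: left_diff_distrib)
  finally show ?thesis .
qed

lemma balanced_shift_iterate_ell1_nonexpansive:
  fixes \<gamma> :: "nat \<Rightarrow> real"
  assumes g: "\<And>n. 0 < \<gamma> n" and mono: "mono \<gamma>" and x: "x \<in> K" and y: "y \<in> K"
  shows "(\<Sum>j. \<bar>(balanced_shift \<gamma> ^^ n) x j - (balanced_shift \<gamma> ^^ n) y j\<bar>) \<le> (\<Sum>j. \<bar>x j - y j\<bar>)"
proof (induction n)
  case (Suc n)
  note iter_K = balanced_shift_iterate_K[OF g mono]
  show ?case
    using balanced_shift_ell1_nonexpansive[OF g mono iter_K[OF x, of n] iter_K[OF y, of n]] Suc
    by simp
qed simp

lemma Lip_L_balanced_shift_iterate: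
  assumes g: "\<And>n. 0 < \<gamma> n" "\<And>n. \<gamma> n < 1" and mono: "mono \<gamma>"
  shows "Lip_L \<gamma> (balanced_shift \<gamma> ^^ n) \<le> ereal (1 / \<gamma> 0)"
  unfolding Lip_L_def
proof (rule SUP_least, clarsimp)
  fix x y
  assume x: "x \<in> K" and y: "y \<in> K"
  let ?T = "balanced_shift \<gamma> ^^ n"
  note iter_K = balanced_shift_iterate_K[OF g(1) mono]
  have "norm_L \<gamma> (?T x - ?T y) \<le> (\<Sum>j. \<bar>?T x j - ?T y j\<bar>)"
    using norm_L_le_ell1[OF g diff_K_ell1[OF iter_K[OF x] iter_K[OF y]]] by simp
  also have "\<dots> \<le> (\<Sum>j. \<bar>x j - y j\<bar>)"
    by (rule balanced_shift_iterate_ell1_nonexpansive[OF g(1) mono x y])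
  finally have le: "norm_L \<gamma> (?T x - ?T y) \<le> (\<Sum>j. \<bar>x j - y j\<bar>)" .
  have ge: "\<gamma> 0 * (\<Sum>j. \<bar>x j - y j\<bar>) \<le> norm_L \<gamma> (x - y)"
    using ell1_le_norm_L[OF g diff_K_ell1[OF x y]] by simp
  have "0 \<le> norm_L \<gamma> (x - y)"
    using norm_L_ge_finite_sum[OF g diff_K_ell1[OF x y], where A = "{}"] by simp
  moreover have "\<gamma> 0 * norm_L \<gamma> (?T x - ?T y) \<le> norm_L \<gamma> (x - y)"
    using mult_left_mono[OF le less_imp_le[OF g(1)[of 0]]] ge by (rule order_trans)
  ultimately show "norm_L \<gamma> (?T x - ?T y) / norm_L \<gamma> (x - y) \<le> 1 / \<gamma> 0"
    using g(1)[of 0] by (cases "norm_L \<gamma> (x - y) = 0") (auto simp: field_simps)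
qed

lemma balanced_shift_not_asymp_Hoelder:
  assumes g: "\<And>n. 0 < \<gamma> n" "\<And>n. \<gamma> n < 1" and mono: "mono \<gamma>" and lim: "\<gamma> \<longlonglongrightarrow> 1"
  shows "\<not> asymp_Hoelder_nonexpansive \<gamma> (balanced_shift \<gamma>)"
proof -
  obtain k where k: "0 < k" "\<gamma> 0 < \<gamma> k"
    using ex_parameter_gt_first[OF g(2) lim] by blast
  have factor: "(\<lambda>n. \<gamma> j / \<gamma> (n + j)) \<longlonglongrightarrow> \<gamma> j" for j
    using tendsto_divide[OF tendsto_const LIMSEQ_ignore_initial_segment[OF lim, of j], of "\<gamma> j"]
    by simp
  show ?thesis
  proof (rule shift_not_asymp_Hoelder[OF g mono lim k(1)])
    show "(balanced_shift \<gamma> ^^ n) x (n + j) = \<gamma> j / \<gamma> (n + j) * x j" for n j x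
      by (rule balanced_shift_iterate[OF g(1)])
    show "0 \<le> \<gamma> j / \<gamma> (n + j)" for n j
      using g(1)[of j] g(1)[of "n + j"] by simp
    show "max (2 * \<gamma> 0) (\<gamma> k) < \<gamma> 0 + \<gamma> k"
      using k(2) g(1)[of 0] by simp
  qed (rule balanced_shift_K[OF g(1) mono] factor; assumption?)+
qed

section \<open>Both shifts together\<close>

theorem proposition4p2:
  fixes \<gamma> :: "nat \<Rightarrow> real"
  assumes "\<And>n. 0 < \<gamma> n" and "\<And>n. \<gamma> n < 1"
    and "mono \<gamma>" and "\<gamma> \<longlonglongrightarrow> 1"
  shows "\<not> asymp_Hoelder_nonexpansive \<gamma> right_shift \<and>
    (affine_on_K (balanced_shift \<gamma>) \<and>
     fixed_point_free_on_K (balanced_shift \<gamma>) \<and>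
     (SUP n\<in>{1..}. Lip_L \<gamma> (balanced_shift \<gamma> ^^ n)) \<le> ereal (1 / \<gamma> 0) \<and>
     \<not> asymp_Hoelder_nonexpansive \<gamma> (balanced_shift \<gamma>))"
proof (intro conjI)
  show "(SUP n\<in>{1..}. Lip_L \<gamma> (balanced_shift \<gamma> ^^ n)) \<le> ereal (1 / \<gamma> 0)"
    using assms by (intro SUP_least Lip_L_balanced_shift_iterate) auto
qed (use assms in \<open>intro right_shift_not_asymp_Hoelder balanced_shift_affine
      balanced_shift_fixed_point_free balanced_shift_not_asymp_Hoelder; simp\<close>)+

end
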